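(* Let $G$ be a finite simple graph and $T$ its toll walk transit function. Then $T$ satisfies Axiom (JC) on $G$ if and only if $G$ is a chordal graph.
   Context: In a finite simple graph $G$, a walk $W=w_1w_2\cdots w_k$ ($k\ge 2$) is a toll walk if $w_1\neq w_k$, $w_2$ is the only neighbor of $w_1$ among the vertices of $W$, and $w_{k-1}$ is the only neighbor of $w_k$ among the vertices of $W$. The toll walk transit function $T$ of $G$ is given by $T(u,u)=\{u\}$ and, for $u\ne v$, $T(u,v)$ is the set of all vertices lying on some toll walk from $u$ to $v$. A graph is chordal if it has no induced cycle of length at least four. Axiom (JC) for $R=T$ on $V=V(G)$: for all pairwise distinct $u,x,y,v\in V$, if $x\in R(u,y)$, $y\in R(x,v)$ and $R(x,y)=\{x,y\}$, then $x\in R(u,v)$. *)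

theory Defs
  imports "Graph_Theory.Graph_Theory"
begin

text \<open>
  A finite simple graph is a \<^locale>\<open>pair_graph\<close>: a finite loop-free digraph without parallel arcs
  whose arc set is symmetric, each edge being represented by its two arcs.
\<close>

text \<open>
  The only-neighbour conditions refer to the set of vertices occurring in the walk, not to
  positions in it.
\<close>
definition toll_walk :: "'a pair_pre_digraph \<Rightarrow> 'a vwalk \<Rightarrow> bool" where
  "toll_walk G W \<longleftrightarrow>
     vwalk W G \<and> 2 \<le> length W \<and> hd W \<noteq> last W \<and>
     {w \<in> set W. (hd W, w) \<in> parcs G} = {W ! 1} \<and>
     {w \<in> set W. (last W, w) \<in> parcs G} = {W ! (length W - 2)}"

definition toll_transit :: "'a pair_pre_digraph \<Rightarrow> 'a \<Rightarrow> 'a \<Rightarrow> 'a set" where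
  "toll_transit G u v =
     (if u = v then {u}
      else \<Union> {set W | W. toll_walk G W \<and> hd W = u \<and> last W = v})"

definition axiom_JC :: "'a set \<Rightarrow> ('a \<Rightarrow> 'a \<Rightarrow> 'a set) \<Rightarrow> bool" where
  "axiom_JC V R \<longleftrightarrow>
     (\<forall>u\<in>V. \<forall>x\<in>V. \<forall>y\<in>V. \<forall>v\<in>V.
        distinct [u, x, y, v] \<longrightarrow>
        x \<in> R u y \<longrightarrow> y \<in> R x v \<longrightarrow> R x y = {x, y} \<longrightarrow> x \<in> R u v)"

text \<open>
  The vertices of \<open>C\<close> are listed in cyclic order; the edges of \<open>G\<close> among them are exactly those
  joining cyclically consecutive entries. The length is at least three, since otherwise a single
  edge would count as a cycle.
\<close>
definition induced_cycle :: "'a pair_pre_digraph \<Rightarrow> 'a list \<Rightarrow> bool" where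
  "induced_cycle G C \<longleftrightarrow>
     3 \<le> length C \<and> distinct C \<and> set C \<subseteq> pverts G \<and>
     (\<forall>i < length C. \<forall>j < length C.
        (C ! i, C ! j) \<in> parcs G \<longleftrightarrow>
          j = Suc i mod length C \<or> i = Suc j mod length C)"

definition chordal :: "'a pair_pre_digraph \<Rightarrow> bool" where
  "chordal G \<longleftrightarrow> \<not> (\<exists>C. induced_cycle G C \<and> 4 \<le> length C)"

end

theory Submission
  imports Defs
begin

text \<open>
  An induced path is a toll walk, and conversely a toll walk contains an induced path with the same
  ends; moreover \<open>T(x, y) = {x, y}\<close> means that \<open>x\<close> and \<open>y\<close> are adjacent. If \<open>x \<in> T(u, y)\<close> and
  \<open>xy\<close> is an edge, then \<open>x\<close> is the only neighbour of \<open>y\<close> on the walk, so there is an induced path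
  from \<open>u\<close> ending in \<open>x, y\<close>; likewise there is an induced path starting with \<open>x, y\<close> and ending
  in \<open>v\<close>. Glue them along \<open>xy\<close>. A contact between the two parts other than the edge \<open>xy\<close>, chosen
  closest to that edge, closes an induced cycle of length at least four. In a chordal graph the glued
  path is therefore induced, and \<open>x \<in> T(u, v)\<close>.
  Conversely, on an induced cycle \<open>u, x, y, \<dots>, v\<close> of length at least four the axiom would give
  \<open>x \<in> T(u, v)\<close>, although \<open>T(u, v) = {u, v}\<close> because \<open>u\<close> and \<open>v\<close> are adjacent.
\<close>

section \<open>Induced paths as vertex lists\<close>

definition induced_path :: "'a pair_pre_digraph \<Rightarrow> 'a list \<Rightarrow> bool" where
  "induced_path G P \<longleftrightarrow>
     P \<noteq> [] \<and> distinct P \<and> set P \<subseteq> pverts G \<and>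
     (\<forall>i < length P. \<forall>j < length P.
        (P ! i, P ! j) \<in> parcs G \<longleftrightarrow> j = Suc i \<or> i = Suc j)"

lemma induced_path_arc_iff:
  assumes "induced_path G P" "i < length P" "j < length P"
  shows "(P ! i, P ! j) \<in> parcs G \<longleftrightarrow> j = Suc i \<or> i = Suc j"
  using assms by (simp add: induced_path_def)

lemma induced_path_nth_eq_iff:
  assumes "induced_path G P" "i < length P" "j < length P"
  shows "P ! i = P ! j \<longleftrightarrow> i = j"
  using assms by (simp add: induced_path_def nth_eq_iff_index_eq)

lemma induced_path_drop:
  assumes "induced_path G P" "k < length P"
  shows "induced_path G (drop k P)"
  using assms set_drop_subset[of k P] by (auto simp: induced_path_def)

lemma induced_path_take:
  assumes "induced_path G P" "0 < k"
  shows "induced_path G (take k P)"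
  using assms set_take_subset[of k P] by (auto simp: induced_path_def)

lemma induced_path_rev:
  assumes "induced_path G P"
  shows "induced_path G (rev P)"
  using assms unfolding induced_path_def by (auto simp: rev_nth)

section \<open>Toll walks and their relation to induced paths\<close>

lemma vwalk_Cons_Cons:
  "vwalk (x # y # zs) (with_proj G) \<longleftrightarrow>
     x \<in> pverts G \<and> (x, y) \<in> parcs G \<and> vwalk (y # zs) (with_proj G)"
  by (auto simp: vwalk_def)

lemma vwalk_nthI:
  assumes "W \<noteq> []" "set W \<subseteq> pverts G"
    and "\<And>i. Suc i < length W \<Longrightarrow> (W ! i, W ! Suc i) \<in> parcs G"
  shows "vwalk W (with_proj G)"
  using assms
proof (induction W rule: vwalk_arcs.induct)
  case (3 x y zs)
  have "vwalk (y # zs) (with_proj G)"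
    using "3.prems"(2) "3.prems"(3)[of "Suc _"] by (intro "3.IH") auto
  then show ?case
    using "3.prems"(2) "3.prems"(3)[of 0] by (simp add: vwalk_Cons_Cons)
qed (auto simp: vwalk_def)

text \<open>Adjacency on an induced path is consecutiveness, so each end has exactly one neighbour
  on the path.\<close>

lemma induced_path_imp_toll_walk:
  assumes P: "induced_path G P" and len: "2 \<le> length P"
  shows "toll_walk G P"
proof -
  have ne: "P \<noteq> []" and dist: "distinct P" and sub: "set P \<subseteq> pverts G"
    using P by (auto simp: induced_path_def)
  have hd: "hd P = P ! 0" and last: "last P = P ! (length P - 1)"
    using ne by (auto simp: hd_conv_nth last_conv_nth)
  have "vwalk P (with_proj G)"
    using ne sub P by (intro vwalk_nthI) (auto simp: induced_path_arc_iff)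
  moreover have "hd P \<noteq> last P"
    unfolding hd last using len ne by (subst induced_path_nth_eq_iff[OF P]) auto
  moreover have "{w \<in> set P. (hd P, w) \<in> parcs G} = {P ! 1}"
  proof -
    have "(hd P, P ! j) \<in> parcs G \<longleftrightarrow> j = 1" if "j < length P" for j
      unfolding hd using ne that by (subst induced_path_arc_iff[OF P]) auto
    then show ?thesis
      using len by (auto simp: in_set_conv_nth intro!: exI[of _ "1"])
  qed
  moreover have "{w \<in> set P. (last P, w) \<in> parcs G} = {P ! (length P - 2)}"
  proof -
    have "(last P, P ! j) \<in> parcs G \<longleftrightarrow> j = length P - 2" if "j < length P" for j
      using len that induced_path_arc_iff[OF P, of "length P - 1" j] by (auto simp: last)
    then show ?thesis
      using len by (auto simp: in_set_conv_nth intro!: exI[of _ "length P - 2"])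
  qed
  ultimately show ?thesis
    using len by (simp add: toll_walk_def)
qed

lemma induced_path_subset_toll_transit:
  assumes "induced_path G P" "2 \<le> length P"
  shows "set P \<subseteq> toll_transit G (hd P) (last P)"
  using induced_path_imp_toll_walk[OF assms]
  by (auto simp: toll_transit_def toll_walk_def)

text \<open>This form avoids positions: once one vertex of \<open>W\<close> is known to be adjacent
  to an end, every other neighbour of that end on \<open>W\<close> must coincide with it.\<close>

lemma toll_walk_neighbour_unique:
  assumes "toll_walk G W" "z \<in> set W" "z' \<in> set W"
  shows "(hd W, z) \<in> parcs G \<Longrightarrow> (hd W, z') \<in> parcs G \<Longrightarrow> z = z'"
    and "(last W, z) \<in> parcs G \<Longrightarrow> (last W, z') \<in> parcs G \<Longrightarrow> z = z'"
proof -
  have nbrs: "{w \<in> set W. (hd W, w) \<in> parcs G} = {W ! 1}"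
    "{w \<in> set W. (last W, w) \<in> parcs G} = {W ! (length W - 2)}"
    using assms by (simp_all add: toll_walk_def)
  show "z = z'" if "(hd W, z) \<in> parcs G" "(hd W, z') \<in> parcs G"
  proof -
    have "z \<in> {W ! 1}" "z' \<in> {W ! 1}"
      unfolding nbrs(1)[symmetric] using that assms by simp_all
    then show ?thesis by simp
  qed
  show "z = z'" if "(last W, z) \<in> parcs G" "(last W, z') \<in> parcs G"
  proof -
    have "z \<in> {W ! (length W - 2)}" "z' \<in> {W ! (length W - 2)}"
      unfolding nbrs(2)[symmetric] using that assms by simp_all
    then show ?thesis by simp
  qed
qed

section \<open>Gluing induced paths and extracting them from walks\<close>

context pair_graph
begin

lemma arc_commute: "(x, y) \<in> parcs G \<longleftrightarrow> (y, x) \<in> parcs G"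
  using pair_sym_arcs by (auto simp: symmetric_def dest: symD)

lemma induced_path_single: "x \<in> pverts G \<Longrightarrow> induced_path G [x]"
  using no_loops' by (auto simp: induced_path_def)

lemma induced_path_append:
  assumes P: "induced_path G P" and Q: "induced_path G Q"
    and disj: "\<And>i j. i < length P \<Longrightarrow> j < length Q \<Longrightarrow> P ! i \<noteq> Q ! j"
    and cross: "\<And>i j. i < length P \<Longrightarrow> j < length Q \<Longrightarrow>
                  (P ! i, Q ! j) \<in> parcs G \<longleftrightarrow> Suc i = length P \<and> j = 0"
  shows "induced_path G (P @ Q)"
proof -
  have cross': "(Q ! j, P ! i) \<in> parcs G \<longleftrightarrow> Suc i = length P \<and> j = 0"
    if "i < length P" "j < length Q" for i j
    by (subst arc_commute) (rule cross[OF that])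
  have sets: "set P \<inter> set Q = {}"
  proof (intro equals0I)
    fix z assume "z \<in> set P \<inter> set Q"
    then obtain i j where "i < length P" "j < length Q" "P ! i = z" "Q ! j = z"
      by (auto simp: in_set_conv_nth)
    then show False using disj[of i j] by simp
  qed
  have split: "i < length P \<or> (\<exists>k. i = length P + k \<and> k < length Q)"
    if "i < length (P @ Q)" for i
    using that by (cases "i < length P") (auto intro!: exI[of _ "i - length P"])
  have "((P @ Q) ! i, (P @ Q) ! j) \<in> parcs G \<longleftrightarrow> j = Suc i \<or> i = Suc j"
    if "i < length (P @ Q)" "j < length (P @ Q)" for i j
    using split[OF that(1)] split[OF that(2)]
    by (elim disjE exE conjE)
       (simp_all add: nth_append cross cross' induced_path_arc_iff[OF P]
         induced_path_arc_iff[OF Q], presburger+)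
  then show ?thesis
    using P Q sets by (simp add: induced_path_def)
qed

text \<open>The successor modulo the total length wraps around only at the last vertex of
  \<open>Q\<close>, so it accounts for the closing edge back to the first vertex of
  \<open>P\<close>. As both parts have at least two vertices, this edge differs from the one at the
  junction.\<close>

lemma induced_cycle_append:
  assumes P: "induced_path G P" and Q: "induced_path G Q"
    and len: "2 \<le> length P" "2 \<le> length Q"
    and disj: "\<And>i j. i < length P \<Longrightarrow> j < length Q \<Longrightarrow> P ! i \<noteq> Q ! j"
    and cross: "\<And>i j. i < length P \<Longrightarrow> j < length Q \<Longrightarrow>
                  (P ! i, Q ! j) \<in> parcs G \<longleftrightarrow>
                  Suc i = length P \<and> j = 0 \<or> i = 0 \<and> Suc j = length Q"
  shows "induced_cycle G (P @ Q)"
proof -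
  have ne: "P \<noteq> []" using len by auto
  have cross': "(Q ! j, P ! i) \<in> parcs G \<longleftrightarrow>
                  Suc i = length P \<and> j = 0 \<or> i = 0 \<and> Suc j = length Q"
    if "i < length P" "j < length Q" for i j
    by (subst arc_commute) (rule cross[OF that])
  have sets: "set P \<inter> set Q = {}"
  proof (intro equals0I)
    fix z assume "z \<in> set P \<inter> set Q"
    then obtain i j where "i < length P" "j < length Q" "P ! i = z" "Q ! j = z"
      by (auto simp: in_set_conv_nth)
    then show False using disj[of i j] by simp
  qed
  have split: "i < length P \<or> (\<exists>k. i = length P + k \<and> k < length Q)"
    if "i < length (P @ Q)" for i
    using that by (cases "i < length P") (auto intro!: exI[of _ "i - length P"])
  have "((P @ Q) ! i, (P @ Q) ! j) \<in> parcs G \<longleftrightarrow>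
      j = Suc i mod length (P @ Q) \<or> i = Suc j mod length (P @ Q)"
    if "i < length (P @ Q)" "j < length (P @ Q)" for i j
    using split[OF that(1)] split[OF that(2)] len ne
    by (elim disjE exE conjE)
       (simp_all add: nth_append cross cross' mod_Suc induced_path_arc_iff[OF P]
         induced_path_arc_iff[OF Q], presburger+)
  then show ?thesis
    using P Q len sets by (simp add: induced_path_def induced_cycle_def)
qed

text \<open>By induction, the tail of the walk contains an induced path \<open>P\<close> from
  \<open>y\<close>. Jumping from \<open>x\<close> to its last neighbour on \<open>P\<close> removes
  all chords at \<open>x\<close>; if \<open>x\<close> is itself the end of \<open>P\<close>, the
  one-vertex path serves.\<close>

lemma vwalk_induced_path:
  assumes "vwalk W (with_proj G)"
  obtains P where "induced_path G P" "set P \<subseteq> set W" "hd P = hd W" "last P = last W"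
proof -
  have "\<exists>P. induced_path G P \<and> set P \<subseteq> set W \<and> hd P = hd W \<and> last P = last W"
    using assms
  proof (induction W rule: vwalk_arcs.induct)
    case 1
    then show ?case by (simp add: vwalk_def)
  next
    case (2 x)
    then show ?case
      using induced_path_single by (intro exI[of _ "[x]"]) (auto simp: vwalk_def)
  next
    case (3 x y zs)
    then have xy: "(x, y) \<in> parcs G" and W: "vwalk (y # zs) (with_proj G)"
      by auto
    have x: "x \<in> pverts G" using xy by (rule in_arcsD1)
    from "3.IH"[OF W] obtain P where P: "induced_path G P" and sub: "set P \<subseteq> set (y # zs)"
      and hd: "hd P = y" and last: "last P = last (y # zs)" by auto
    have ne: "P \<noteq> []" using P by (simp add: induced_path_def)
    show ?case
    proof (cases "x = last P")
      case True
      then show ?thesis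
        using induced_path_single[OF x] last by (intro exI[of _ "[x]"]) auto
    next
      case False
      let ?A = "\<lambda>i. i < length P \<and> (x, P ! i) \<in> parcs G"
      have "?A 0" using ne hd xy by (simp add: hd_conv_nth)
      then obtain k where k: "?A k" and max: "\<And>i. ?A i \<Longrightarrow> i \<le> k"
        using ex_has_greatest_nat[of ?A 0 id "length P"] by auto
      \<comment> \<open>If \<open>x\<close> occurred on \<open>P\<close> at or after index
        \<open>k\<close>, it would not be the last vertex, and its successor would be a neighbour of
        \<open>x\<close> beyond \<open>k\<close>.\<close>
      have notin: "x \<noteq> P ! i" if "k \<le> i" "i < length P" for i
      proof
        assume eq: "x = P ! i"
        with False ne have "i \<noteq> length P - 1"
          by (metis last_conv_nth)
        with that have "Suc i < length P" by simp
        with eq P have "?A (Suc i)"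
          by (simp add: induced_path_arc_iff)
        with max[of "Suc i"] that show False by simp
      qed
      have "induced_path G ([x] @ drop k P)"
      proof (rule induced_path_append[OF induced_path_single[OF x] induced_path_drop[OF P]])
        show "k < length P" using k by simp
      next
        fix i j assume "i < length [x]" "j < length (drop k P)"
        then show "[x] ! i \<noteq> drop k P ! j"
          using notin[of "k + j"] by simp
      next
        fix i j assume ij: "i < length [x]" "j < length (drop k P)"
        then show "([x] ! i, drop k P ! j) \<in> parcs G \<longleftrightarrow> Suc i = length [x] \<and> j = 0"
          using k max[of "k + j"] by (cases "j = 0") (auto simp: less_diff_conv add.commute)
      qed
      then show ?thesis
        using k last sub set_drop_subset[of k P] by (intro exI[of _ "x # drop k P"]) auto
    qed
  qed
  then show thesis using that by blast
qed

section \<open>The toll transit function across an edge\<close>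

lemma toll_transit_adjacent:
  assumes xy: "(x, y) \<in> parcs G"
  shows "toll_transit G x y = {x, y}"
proof
  have neq: "x \<noteq> y" using xy no_loops' by blast
  have "induced_path G ([x] @ [y])"
    using xy neq in_arcsD1[OF xy] in_arcsD2[OF xy]
    by (intro induced_path_append induced_path_single) auto
  then have P: "induced_path G [x, y]" by simp
  show "{x, y} \<subseteq> toll_transit G x y"
    using induced_path_subset_toll_transit[OF P] by simp
  show "toll_transit G x y \<subseteq> {x, y}"
  proof
    fix w assume "w \<in> toll_transit G x y"
    then obtain W where W: "toll_walk G W" "hd W = x" "last W = y" and w: "w \<in> set W"
      using neq by (auto simp: toll_transit_def)
    have walk: "vwalk W (with_proj G)" and ne: "W \<noteq> []"
      using W by (auto simp: toll_walk_def vwalk_def)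
    have mem: "x \<in> set W" "y \<in> set W"
      using W ne by auto
    have yx: "(y, x) \<in> parcs G" using xy by (subst arc_commute)
    have x_only: "z = y" if "z \<in> set W" "(x, z) \<in> parcs G" for z
      using toll_walk_neighbour_unique(1)[OF W(1) that(1) mem(2)] that(2) xy W(2) by simp
    have y_only: "z = x" if "z \<in> set W" "(y, z) \<in> parcs G" for z
      using toll_walk_neighbour_unique(2)[OF W(1) that(1) mem(1)] that(2) yx W(3) by simp
    \<comment> \<open>A toll walk between adjacent ends cannot leave them, since on it each end has
      only the other as a neighbour. For the induction on suffixes, \<open>U\<close> may start at
      either end and need only stay within the vertices of \<open>W\<close>.\<close>
    have "set U \<subseteq> {x, y}" if "vwalk U (with_proj G)" "hd U \<in> {x, y}" "set U \<subseteq> set W" for U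
      using that
    proof (induction U rule: vwalk_arcs.induct)
      case (3 a b zs)
      then have "b \<in> {x, y}" using x_only y_only by auto
      with 3 show ?case by auto
    qed auto
    from this[OF walk] W w show "w \<in> {x, y}" by auto
  qed
qed

lemma toll_transit_eq_pair_iff:
  assumes "x \<noteq> y"
  shows "toll_transit G x y = {x, y} \<longleftrightarrow> (x, y) \<in> parcs G"
proof
  assume T: "toll_transit G x y = {x, y}"
  then obtain W where W: "toll_walk G W" "hd W = x" "last W = y"
    using assms by (auto simp: toll_transit_def)
  then have "set W \<subseteq> {x, y}"
    using T assms by (auto simp: toll_transit_def)
  \<comment> \<open>The second vertex of \<open>W\<close> is a neighbour of \<open>x\<close> inside
    \<open>{x, y}\<close>; as there are no loops, it is \<open>y\<close>.\<close>
  moreover have "W ! 1 \<in> set W" "(x, W ! 1) \<in> parcs G"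
    using W by (auto simp: toll_walk_def)
  ultimately show "(x, y) \<in> parcs G"
    using no_loops' by blast
qed (rule toll_transit_adjacent)

lemma toll_transit_rev:
  assumes "w \<in> toll_transit G u v"
  shows "w \<in> toll_transit G v u"
proof (cases "u = v")
  case False
  then obtain W where W: "toll_walk G W" "hd W = u" "last W = v" and w: "w \<in> set W"
    using assms by (auto simp: toll_transit_def)
  have len: "2 \<le> length W" using W by (simp add: toll_walk_def)
  have "vwalk (rev W) (with_proj G)"
  proof -
    have "set (vwalk_arcs W) \<subseteq> parcs G" "set W \<subseteq> pverts G" "W \<noteq> []"
      using W by (auto simp: toll_walk_def vwalk_def)
    moreover from this(1) have "set (vwalk_arcs (rev W)) \<subseteq> parcs G"
      unfolding set_vwalk_arcs_rev by (auto intro: arc_commute[THEN iffD1])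
    ultimately show ?thesis by (simp add: vwalk_def)
  qed
  then have "toll_walk G (rev W)"
    using W len by (auto simp: toll_walk_def hd_rev last_rev rev_nth numeral_2_eq_2)
  with W w False show ?thesis
    by (auto simp: toll_transit_def hd_rev last_rev intro!: exI[of _ "set (rev W)"] exI[of _ "rev W"])
qed (use assms in simp)

text \<open>The only neighbour of \<open>y\<close> on the toll walk is \<open>x\<close>. An induced
  path extracted from the walk uses only vertices of the walk, so its penultimate vertex must be
  \<open>x\<close>; as \<open>u\<close> differs from \<open>x\<close>, something precedes
  it.\<close>

lemma toll_transit_adjacent_induced_path:
  assumes x: "x \<in> toll_transit G u y" and xy: "(x, y) \<in> parcs G" and ne: "u \<noteq> x" "u \<noteq> y"
  obtains P where "induced_path G (P @ [x, y])" "hd (P @ [x, y]) = u" "P \<noteq> []"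
proof -
  obtain W where W: "toll_walk G W" "hd W = u" "last W = y" and xW: "x \<in> set W"
    using x ne by (auto simp: toll_transit_def)
  have yx: "(y, x) \<in> parcs G" using xy by (subst arc_commute)
  have y_only: "z = x" if "z \<in> set W" "(y, z) \<in> parcs G" for z
    using toll_walk_neighbour_unique(2)[OF W(1) that(1) xW] that(2) yx W(3) by simp
  obtain P where P: "induced_path G P" and sub: "set P \<subseteq> set W" and hd: "hd P = u" and last: "last P = y"
    using vwalk_induced_path[of W] W by (auto simp: toll_walk_def)
  obtain P' where P': "P = P' @ [y]"
    using P last by (cases P rule: rev_cases) (auto simp: induced_path_def)
  obtain Q z where Q: "P' = Q @ [z]"
    using P' hd ne by (cases P' rule: rev_cases) auto
  have "(P ! length P', P ! length Q) \<in> parcs G"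
    using P' Q by (subst induced_path_arc_iff[OF P]) auto
  then have "(y, z) \<in> parcs G" using P' Q by (auto simp: nth_append)
  then have "z = x" using y_only sub P' Q by auto
  then have "P = Q @ [x, y]" "Q \<noteq> []"
    using P' Q hd ne by auto
  then show thesis using that P hd by blast
qed

section \<open>Chordal graphs satisfy the axiom\<close>

text \<open>The two given paths overlap in the edge \<open>xy\<close>. The extra vertices record
  that \<open>y\<close> touches \<open>P\<close> only through its end \<open>x\<close>, and
  \<open>x\<close> touches \<open>Q\<close> only through its start \<open>y\<close>.\<close>

lemma chordal_induced_path_append:
  assumes ch: "chordal G"
    and P': "induced_path G (P @ [y])" and Q': "induced_path G (x # Q)"
    and ne: "P \<noteq> []" "Q \<noteq> []" and x: "last P = x" and y: "hd Q = y"
  shows "induced_path G (P @ Q)"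
proof -
  define m where "m = length P - 1"
  have m: "length P = Suc m" using ne by (simp add: m_def)
  have P: "induced_path G P"
    using induced_path_take[OF P', of "length P"] ne by simp
  have Q: "induced_path G Q"
    using induced_path_drop[OF Q', of 1] ne by simp
  have Pm: "P ! m = x" and Q0: "Q ! 0 = y"
    using ne x y by (auto simp: last_conv_nth hd_conv_nth m_def)
  have Py: "(P ! i, y) \<in> parcs G \<longleftrightarrow> i = m" "P ! i \<noteq> y" if "i \<le> m" for i
    using that induced_path_arc_iff[OF P', of i "length P"]
      induced_path_nth_eq_iff[OF P', of i "length P"] by (auto simp: nth_append m)
  have xQ: "(x, Q ! j) \<in> parcs G \<longleftrightarrow> j = 0" "x \<noteq> Q ! j" if "j < length Q" for j
    using that induced_path_arc_iff[OF Q', of 0 "Suc j"]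
      induced_path_nth_eq_iff[OF Q', of 0 "Suc j"] by auto
  \<comment> \<open>Any contact between \<open>P\<close> and \<open>Q\<close>, adjacency or a common vertex, other than the edge \<open>xy\<close>.\<close>
  let ?bad = "\<lambda>i j. i \<le> m \<and> j < length Q \<and>
    (P ! i = Q ! j \<or> (P ! i, Q ! j) \<in> parcs G) \<and> \<not> (i = m \<and> j = 0)"
  have good: "\<not> ?bad i j" for i j
  proof
    assume "?bad i j"
    let ?K = "{i. \<exists>j. ?bad i j}"
    \<comment> \<open>The extremal contact: \<open>k\<close> is the index in \<open>P\<close>
      nearest to \<open>x\<close> that has any contact, and \<open>l\<close> below is the index
      nearest to \<open>y\<close> among the contacts of \<open>P ! k\<close>.\<close>
    define k where "k = Max ?K"
    have fin: "finite ?K" by (rule finite_subset[of _ "{..m}"]) auto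
    have "k \<in> ?K"
      unfolding k_def using \<open>?bad i j\<close> by (intro Max_in[OF fin]) blast
    then obtain j where "?bad k j" by blast
    have max: "i \<le> k" if "?bad i j" for i j
      unfolding k_def using that by (intro Max_ge[OF fin]) blast
    define l where "l = (LEAST j. ?bad k j)"
    have kl: "?bad k l" unfolding l_def using \<open>?bad k j\<close> by (rule LeastI)
    have min: "l \<le> j" if "?bad k j" for j
      unfolding l_def using that by (rule Least_le)
    \<comment> \<open>The only contact of \<open>x\<close> with \<open>Q\<close> is
      \<open>y\<close>, and the only contact of \<open>y\<close> with \<open>P\<close> is
      \<open>x\<close>. Hence the extremal contact avoids both, which later gives at least two
      vertices on each side of the cycle.\<close>
    have k: "k < m" using kl xQ Pm by (cases "k = m") auto
    have l: "0 < l" using kl k Py[of k] Q0 by (cases "l = 0") auto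
    \<comment> \<open>If the contact were a common vertex, its predecessor
      \<open>Q ! (l - 1)\<close> would be adjacent to \<open>P ! k\<close>, against the minimality
      of \<open>l\<close>.\<close>
    have arc: "(P ! k, Q ! l) \<in> parcs G"
    proof (rule ccontr)
      assume "(P ! k, Q ! l) \<notin> parcs G"
      then have "(P ! k, Q ! (l - 1)) \<in> parcs G"
        using kl l induced_path_arc_iff[OF Q, of l "l - 1"] by auto
      then have "?bad k (l - 1)" using kl k by auto
      with min[of "l - 1"] l show False by simp
    qed
    \<comment> \<open>Extremality leaves only the pair \<open>k\<close>, \<open>l\<close> for a
      common vertex, and there the arc just found would be a loop.\<close>
    have disj: "P ! i \<noteq> Q ! j" if "k \<le> i" "i \<le> m" "j \<le> l" for i j
    proof
      assume eq: "P ! i = Q ! j"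
      have "i \<noteq> m" using eq that kl xQ Pm by auto
      then have "?bad i j" using eq that kl by auto
      with max that have "i = k" by (meson le_antisym)
      with min \<open>?bad i j\<close> that have "j = l" by (meson le_antisym)
      then have "(P ! k, P ! k) \<in> parcs G" using arc eq \<open>i = k\<close> by simp
      then show False using no_loops' by blast
    qed
    have cross: "(P ! i, Q ! j) \<in> parcs G \<longleftrightarrow> i = m \<and> j = 0 \<or> i = k \<and> j = l"
      if "k \<le> i" "i \<le> m" "j \<le> l" for i j
    proof
      assume a: "(P ! i, Q ! j) \<in> parcs G"
      show "i = m \<and> j = 0 \<or> i = k \<and> j = l"
      proof (rule ccontr)
        assume c: "\<not> (i = m \<and> j = 0 \<or> i = k \<and> j = l)"
        then have "?bad i j" using a that kl by auto
        with max that have "i = k" by (meson le_antisym)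
        with min \<open>?bad i j\<close> that have "j = l" by (meson le_antisym)
        with c \<open>i = k\<close> show False by simp
      qed
    qed (use arc xQ[of 0] Pm ne in auto)
    have lens: "length (drop k P) = Suc m - k" "length (take (Suc l) Q) = Suc l"
      using m kl by auto
    \<comment> \<open>The cycle runs along \<open>P\<close> from \<open>P ! k\<close> to
      \<open>x\<close>, crosses to \<open>y\<close>, follows \<open>Q\<close> to
      \<open>Q ! l\<close> and closes by \<open>arc\<close>.\<close>
    have "induced_cycle G (drop k P @ take (Suc l) Q)"
    proof (rule induced_cycle_append[OF induced_path_drop[OF P] induced_path_take[OF Q]])
      fix i j assume "i < length (drop k P)" "j < length (take (Suc l) Q)"
      then have ij: "k + i \<le> m" "j \<le> l" using lens by auto
      then have nth: "drop k P ! i = P ! (k + i)" "take (Suc l) Q ! j = Q ! j"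
        using m by auto
      show "drop k P ! i \<noteq> take (Suc l) Q ! j"
        unfolding nth using ij by (intro disj) auto
      show "(drop k P ! i, take (Suc l) Q ! j) \<in> parcs G \<longleftrightarrow>
          Suc i = length (drop k P) \<and> j = 0 \<or> i = 0 \<and> Suc j = length (take (Suc l) Q)"
        unfolding nth lens using ij k by (subst cross) auto
    qed (use lens k l m in auto)
    moreover have "4 \<le> length (drop k P @ take (Suc l) Q)"
      unfolding length_append lens using k l by simp
    ultimately show False using ch unfolding chordal_def by blast
  qed
  show ?thesis
  proof (rule induced_path_append[OF P Q])
    fix i j assume ij: "i < length P" "j < length Q"
    show "P ! i \<noteq> Q ! j"
      using good[of i j] ij m Pm xQ(2)[of j] by (cases "i = m \<and> j = 0") auto
    show "(P ! i, Q ! j) \<in> parcs G \<longleftrightarrow> Suc i = length P \<and> j = 0"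
      using good[of i j] ij m Pm xQ(1)[of j] by auto
  qed
qed

lemma chordal_imp_axiom_JC:
  assumes "chordal G"
  shows "axiom_JC (pverts G) (toll_transit G)"
  unfolding axiom_JC_def
proof (intro ballI impI)
  fix u x y v
  assume dist: "distinct [u, x, y, v]" and x: "x \<in> toll_transit G u y"
    and y: "y \<in> toll_transit G x v" and T: "toll_transit G x y = {x, y}"
  from T dist have xy: "(x, y) \<in> parcs G"
    by (simp add: toll_transit_eq_pair_iff)
  obtain P where P: "induced_path G (P @ [x, y])" "hd (P @ [x, y]) = u" "P \<noteq> []"
    using toll_transit_adjacent_induced_path[OF x xy] dist by auto
  have yx: "(y, x) \<in> parcs G" using xy by (subst arc_commute)
  \<comment> \<open>Reversal turns \<open>y \<in> T(x, v)\<close> into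
    \<open>y \<in> T(v, x)\<close>, so the same extraction yields a path from \<open>v\<close>
    ending in \<open>y\<close>, \<open>x\<close>.\<close>
  obtain Q where Q: "induced_path G (Q @ [y, x])" "hd (Q @ [y, x]) = v" "Q \<noteq> []"
    using toll_transit_adjacent_induced_path[OF toll_transit_rev[OF y] yx] dist by auto
  have "induced_path G (x # y # rev Q)"
    using induced_path_rev[OF Q(1)] by simp
  moreover have "induced_path G ((P @ [x]) @ [y])"
    using P(1) by simp
  ultimately have "induced_path G ((P @ [x]) @ (y # rev Q))"
    using chordal_induced_path_append[OF assms, of "P @ [x]" y x "y # rev Q"] by simp
  from induced_path_subset_toll_transit[OF this] P Q show "x \<in> toll_transit G u v"
    by (auto simp: last_rev hd_append)
qed

section \<open>The axiom excludes long induced cycles\<close>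

lemma induced_cycle_arc_iff:
  assumes "induced_cycle G C" "i < length C" "j < length C"
  shows "(C ! i, C ! j) \<in> parcs G \<longleftrightarrow> j = Suc i mod length C \<or> i = Suc j mod length C"
  using assms by (simp add: induced_cycle_def)

text \<open>As \<open>k\<close> is positive, index 0 is removed and with it the only place where the
  successor wraps around.\<close>

lemma induced_cycle_induced_path_drop:
  assumes C: "induced_cycle G C" and k: "0 < k" "k < length C"
  shows "induced_path G (drop k C)"
proof -
  have "(drop k C ! i, drop k C ! j) \<in> parcs G \<longleftrightarrow> j = Suc i \<or> i = Suc j"
    if "i < length (drop k C)" "j < length (drop k C)" for i j
  proof -
    have "k + i < length C" "k + j < length C" using that by auto
    then show ?thesis
      using k induced_cycle_arc_iff[OF C, of "k + i" "k + j"] by (simp add: mod_Suc)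
  qed
  moreover have "set (drop k C) \<subseteq> pverts G" "distinct C"
    using C set_drop_subset[of k C] unfolding induced_cycle_def by blast+
  ultimately show ?thesis
    using k by (simp add: induced_path_def)
qed

text \<open>As \<open>k\<close> is less than the length, the last vertex is removed, so no successor
  of a remaining index wraps around.\<close>

lemma induced_cycle_induced_path_take:
  assumes C: "induced_cycle G C" and k: "0 < k" "k < length C"
  shows "induced_path G (take k C)"
proof -
  have "(take k C ! i, take k C ! j) \<in> parcs G \<longleftrightarrow> j = Suc i \<or> i = Suc j"
    if "i < length (take k C)" "j < length (take k C)" for i j
    using k that induced_cycle_arc_iff[OF C, of i j] by simp
  moreover have "set (take k C) \<subseteq> pverts G" "distinct C"
    using C set_take_subset[of k C] unfolding induced_cycle_def by blast+
  ultimately show ?thesis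
    using k by (auto simp: induced_path_def)
qed

lemma axiom_JC_imp_chordal:
  assumes JC: "axiom_JC (pverts G) (toll_transit G)"
  shows "chordal G"
proof (rule ccontr)
  assume "\<not> chordal G"
  then obtain C where C: "induced_cycle G C" and len: "4 \<le> length C"
    by (auto simp: chordal_def)
  \<comment> \<open>\<open>v\<close> is the last entry and hence cyclically adjacent to
    \<open>u\<close>; \<open>D\<close> is empty for a cycle of length four.\<close>
  obtain u x y D v where CD: "C = u # x # y # D @ [v]"
  proof -
    obtain u x y E where E: "C = u # x # y # E" "E \<noteq> []"
      using len by (auto simp: Suc_le_length_iff numeral_eq_Suc)
    then show thesis using that[of u x y "butlast E" "last E"] by simp
  qed
  have dist: "distinct [u, x, y, v]" and V: "u \<in> pverts G" "x \<in> pverts G" "y \<in> pverts G" "v \<in> pverts G"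
    using C CD by (auto simp: induced_cycle_def)
  have "x \<in> toll_transit G u y"
    \<comment> \<open>The first three entries form the path \<open>u\<close>, \<open>x\<close>,
      \<open>y\<close>; dropping only \<open>u\<close> gives the path from \<open>x\<close> through
      \<open>y\<close> to \<open>v\<close> used next.\<close>
    using induced_path_subset_toll_transit[OF induced_cycle_induced_path_take[OF C, of 3]]
    by (simp add: CD numeral_3_eq_3)
  moreover have "y \<in> toll_transit G x v"
    using induced_path_subset_toll_transit[OF induced_cycle_induced_path_drop[OF C, of 1]]
    by (simp add: CD)
  moreover have arc: "(C ! i, C ! j) \<in> parcs G \<longleftrightarrow> j = Suc i mod length C \<or> i = Suc j mod length C"
    if "i < length C" "j < length C" for i j
    using induced_cycle_arc_iff[OF C that] .
  have "(x, y) \<in> parcs G"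
    using arc[of 1 2] len by (simp add: CD)
  then have "toll_transit G x y = {x, y}" by (rule toll_transit_adjacent)
  ultimately have "x \<in> toll_transit G u v"
    using JC dist V unfolding axiom_JC_def by blast
  moreover have "(u, v) \<in> parcs G"
    using arc[of 0 "length C - 1"] by (simp add: CD nth_append)
  then have "toll_transit G u v = {u, v}" by (rule toll_transit_adjacent)
  ultimately show False using dist by simp
qed

end

theorem theorem3:
  fixes G :: "'a pair_pre_digraph"
  assumes "pair_graph G"
  shows "axiom_JC (pverts G) (toll_transit G) \<longleftrightarrow> chordal G"
  using pair_graph.axiom_JC_imp_chordal[OF assms] pair_graph.chordal_imp_axiom_JC[OF assms]
  by blast

end
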